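(* For every $0<c<1$, the pair $(X_c,X_c)$ does not have the weak maximizing property.
   Context: All Banach spaces are real. $\mathcal L(E,F)$ denotes the bounded linear operators from $E$ to $F$; $S_E$ is the unit sphere of $E$. An operator $T\in\mathcal L(E,F)$ attains its norm if $\|Tx\|=\|T\|$ for some $x\in S_E$. A sequence $(x_n)\subset S_E$ is a maximizing sequence for $T$ if $\|Tx_n\|\to\|T\|$. A pair $(E,F)$ has the weak maximizing property (WMP) if every $T\in\mathcal L(E,F)$ which admits a maximizing sequence that is not weakly null attains its norm. Definition of $X_c$. A norm $N$ on $\mathbb R^2$ is absolute if $N(s,t)=N(|s|,|t|)$ and normalized if $N(1,0)=N(0,1)=1$. Given a sequence $(N_n)_{n\ge1}$ of absolute normalized norms on $\mathbb R^2$, define norms $M_n$ on $\mathbb R^{n+1}$ by $M_0(x_0)=|x_0|$ and $M_n(x_0,\dots,x_n)=N_n(M_{n-1}(x_0,\dots,x_{n-1}),|x_n|)$ for $n\ge1$. For a finitely supported real sequence $x=(x_j)_{j\ge0}\in c_{00}$ put $\|x\|=M_n(x_0,\dots,x_n)$ for any $n$ with $x_j=0$ for all $j>n$ (this is independent of $n$). $A(N_n)$ denotes the completion of $c_{00}$ in this norm, with canonical basis $(e_j)_{j\ge0}$. For $0<c<1$ and $n\ge1$ let $$N_{n,c}(s,t)=\left[(1-c^{2n})|t|^{2n}+(s^2+c^2t^2)^n\right]^{1/(2n)},$$ which is an absolute normalized norm on $\mathbb R^2$, and set $X_c:=A(N_{n,c})$. *)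

theory Defs
  imports "HOL-Analysis.Analysis"
begin

definition attains_norm :: "('a::real_normed_vector \<Rightarrow>\<^sub>L 'b::real_normed_vector) \<Rightarrow> bool" where
  "attains_norm T \<longleftrightarrow> (\<exists>x. norm x = 1 \<and> norm (blinfun_apply T x) = norm T)"

definition maximizing_sequence ::
    "('a::real_normed_vector \<Rightarrow>\<^sub>L 'b::real_normed_vector) \<Rightarrow> (nat \<Rightarrow> 'a) \<Rightarrow> bool" where
  "maximizing_sequence T x \<longleftrightarrow>
     (\<forall>n. norm (x n) = 1) \<and> (\<lambda>n. norm (blinfun_apply T (x n))) \<longlonglongrightarrow> norm T"

definition weakly_null :: "(nat \<Rightarrow> 'a::real_normed_vector) \<Rightarrow> bool" where
  "weakly_null x \<longleftrightarrow> (\<forall>f :: 'a \<Rightarrow>\<^sub>L real. (\<lambda>n. blinfun_apply f (x n)) \<longlonglongrightarrow> 0)"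

definition weak_maximizing_property :: "'a::banach itself \<Rightarrow> 'b::banach itself \<Rightarrow> bool" where
  "weak_maximizing_property E F \<longleftrightarrow>
     (\<forall>T :: 'a \<Rightarrow>\<^sub>L 'b.
        (\<exists>x. maximizing_sequence T x \<and> \<not> weakly_null x) \<longrightarrow> attains_norm T)"

text \<open>A sequence of norms on the plane is a curried function \<open>N\<close>, of which only the values
  \<open>N n\<close> with \<open>n \<ge> 1\<close> matter. The number \<open>iterated_norm N n x\<close> is
  \<open>M\<^sub>n(x\<^sub>0, \<dots>, x\<^sub>n)\<close>; it depends only on the first \<open>n + 1\<close> entries of \<open>x\<close>.\<close>

primrec iterated_norm :: "(nat \<Rightarrow> real \<Rightarrow> real \<Rightarrow> real) \<Rightarrow> nat \<Rightarrow> (nat \<Rightarrow> real) \<Rightarrow> real" where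
  "iterated_norm N 0 x = \<bar>x 0\<bar>"
| "iterated_norm N (Suc n) x = N (Suc n) (iterated_norm N n x) \<bar>x (Suc n)\<bar>"

text \<open>\<open>is_A_space N e\<close> says that the Banach space \<open>'a\<close>, with canonical basis \<open>e\<close>, is the
  completion \<open>A(N\<^sub>n)\<close> of the space of finitely supported sequences: the linear map that sends
  the unit sequences to the vectors \<open>e j\<close> is isometric and has dense range.
  As a completion this determines \<open>'a\<close> and \<open>e\<close> up to a unique isometric isomorphism. A predicate
  is used because a type cannot depend on \<open>N\<close>.\<close>

definition is_A_space :: "(nat \<Rightarrow> real \<Rightarrow> real \<Rightarrow> real) \<Rightarrow> (nat \<Rightarrow> 'a::banach) \<Rightarrow> bool" where
  "is_A_space N e \<longleftrightarrow>
     (\<forall>x n. (\<forall>j>n. x j = 0) \<longrightarrow> norm (\<Sum>j\<le>n. x j *\<^sub>R e j) = iterated_norm N n x) \<and>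
     closure (span (range e)) = UNIV"

definition N_c :: "real \<Rightarrow> nat \<Rightarrow> real \<Rightarrow> real \<Rightarrow> real" where
  "N_c c n s t =
     root (2 * n) ((1 - c ^ (2 * n)) * \<bar>t\<bar> ^ (2 * n) + (s\<^sup>2 + c\<^sup>2 * t\<^sup>2) ^ n)"

definition is_X_c :: "real \<Rightarrow> (nat \<Rightarrow> 'a::banach) \<Rightarrow> bool" where
  "is_X_c c e \<longleftrightarrow> is_A_space (N_c c) e"

end

theory Submission
  imports Defs
begin

text \<open>For \<open>s = sqrt (1 - c\<^sup>2)\<close> the norm of \<open>s e\<^sub>0 + e\<^sub>n\<close> tends to 1, the norm of \<open>e\<^sub>n\<close>: the component
  along \<open>e\<^sub>0\<close> is hidden by the larger component along \<open>e\<^sub>n\<close> (\<open>N_c_flat\<close>). The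
  counterexample is a diagonal operator whose entries increase to 1 and stay below it, for
  instance \<open>T e\<^sub>j = \<beta>\<^sub>j e\<^sub>j\<close> with \<open>\<beta>\<^sub>j = 1 - 1/(j + 2)\<close>.

  The basis is 1-unconditional, so diagonal operators with entries in \<open>[-1, 1]\<close> are contractions
  and \<open>T\<close> has norm 1. The normalized vectors \<open>s e\<^sub>0 + e\<^sub>n\<close> form a maximizing sequence,
  and their coordinate at \<open>e\<^sub>0\<close> tends to \<open>s > 0\<close>, so the sequence is not weakly null
  (\<open>not_weak_maximizing_property\<close>).

  The norm of \<open>T\<close> is not attained (\<open>increasing_diagonal_strictly_decreases_norm\<close>). Given
  \<open>x \<noteq> 0\<close>, its projection to the coordinates beyond \<open>n\<close> has smaller norm than \<open>x\<close> if \<open>n\<close> is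
  large, and \<open>\<parallel>T x\<parallel>\<close> is at most the convex combination of \<open>\<parallel>x\<parallel>\<close> and the norm of that
  projection with weights \<open>\<beta>\<^sub>n\<close> and \<open>1 - \<beta>\<^sub>n\<close>.\<close>

section \<open>Contractions determined by their values on a sequence\<close>

lemma span_range_eq_finite_sums:
  fixes v :: "nat \<Rightarrow> 'v::real_vector"
  assumes "y \<in> span (range v)"
  obtains x n where "\<forall>j>n. x j = (0::real)" and "y = (\<Sum>j\<le>n. x j *\<^sub>R v j)"
proof -
  have "\<exists>x n. (\<forall>j>n. x j = (0::real)) \<and> y = (\<Sum>j\<le>n. x j *\<^sub>R v j)"
    using assms
  proof (induction rule: span_induct_alt)
    case base
    show ?case by (rule exI[of _ "\<lambda>_. 0"]) simp
  next
    case (step a w y)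
    then obtain k x n where w: "w = v k" and x: "\<forall>j>n. x j = 0" "y = (\<Sum>j\<le>n. x j *\<^sub>R v j)"
      by blast
    define m where "m = max n k"
    have "y = (\<Sum>j\<le>m. x j *\<^sub>R v j)"
      unfolding x(2) by (rule sum.mono_neutral_left) (use x(1) in \<open>auto simp: m_def\<close>)
    moreover have "a *\<^sub>R w = (\<Sum>j\<le>m. (if j = k then a else 0) *\<^sub>R v j)"
      by (simp add: w m_def if_distrib[of "\<lambda>r. r *\<^sub>R _"] cong: if_cong)
    ultimately have "a *\<^sub>R w + y = (\<Sum>j\<le>m. ((if j = k then a else 0) + x j) *\<^sub>R v j)"
      by (simp add: scaleR_add_left sum.distrib)
    moreover have "\<forall>j>m. (if j = k then a else 0) + x j = 0"
      using x(1) by (auto simp: m_def)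
    ultimately show ?case
      by (intro exI[of _ "\<lambda>j. (if j = k then a else 0) + x j"] exI[of _ m] conjI)
  qed
  with that show thesis by blast
qed

lemma subspace_closure:
  fixes S :: "'v::real_normed_vector set"
  assumes "subspace S"
  shows "subspace (closure S)"
proof (rule subspaceI)
  show "0 \<in> closure S"
    using closure_subset subspace_0[OF assms] by blast
next
  fix p q
  assume "p \<in> closure S" "q \<in> closure S"
  then obtain P Q where "\<forall>n. P n \<in> S" "P \<longlonglongrightarrow> p" "\<forall>n. Q n \<in> S" "Q \<longlonglongrightarrow> q"
    unfolding closure_sequential by blast
  then have "(\<forall>n. P n + Q n \<in> S) \<and> (\<lambda>n. P n + Q n) \<longlonglongrightarrow> p + q"
    using subspace_add[OF assms] by (auto intro: tendsto_add)
  then show "p + q \<in> closure S"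
    unfolding closure_sequential by (rule exI[of _ "\<lambda>n. P n + Q n"])
next
  fix r p
  assume "p \<in> closure S"
  then obtain P where "\<forall>n. P n \<in> S" "P \<longlonglongrightarrow> p"
    unfolding closure_sequential by blast
  then have "(\<forall>n. r *\<^sub>R P n \<in> S) \<and> (\<lambda>n. r *\<^sub>R P n) \<longlonglongrightarrow> r *\<^sub>R p"
    using subspace_scale[OF assms] by (auto intro: tendsto_scaleR)
  then show "r *\<^sub>R p \<in> closure S"
    unfolding closure_sequential by (rule exI[of _ "\<lambda>n. r *\<^sub>R P n"])
qed

text \<open>The closure of the relation is the graph of the operator: the norm bound passes to the
  closure, where it makes the relation single-valued, and it turns a Cauchy sequence of first
  components into one of second components, which makes the closed relation total.\<close>

lemma contractive_subspace_extends_to_blinfun: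
  fixes R :: "('a::real_normed_vector \<times> 'b::banach) set"
  assumes R: "subspace R" and contr: "\<And>y w. (y, w) \<in> R \<Longrightarrow> norm w \<le> norm y"
    and dense: "closure (fst ` R) = UNIV"
  obtains T :: "'a \<Rightarrow>\<^sub>L 'b" where "norm T \<le> 1" and "\<And>y w. (y, w) \<in> R \<Longrightarrow> blinfun_apply T y = w"
proof -
  define G where "G = closure R"
  have G: "subspace G"
    unfolding G_def by (rule subspace_closure[OF R])
  have "closed {p :: 'a \<times> 'b. norm (snd p) \<le> norm (fst p)}"
    by (intro closed_Collect_le continuous_intros)
  then have "G \<subseteq> {p. norm (snd p) \<le> norm (fst p)}"
    unfolding G_def by (rule closure_minimal[rotated]) (use contr in auto)
  then have G_contr: "norm w \<le> norm y" if "(y, w) \<in> G" for y w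
    using that by auto
  have uniq: "w = w'" if "(y, w) \<in> G" "(y, w') \<in> G" for y w w'
    using G_contr[of 0 "w - w'"] subspace_diff[OF G that] by simp
  have total: "\<exists>w. (y, w) \<in> G" for y
  proof -
    have "y \<in> closure (fst ` R)"
      by (simp add: dense)
    then obtain q where q: "\<forall>n. q n \<in> fst ` R" "q \<longlonglongrightarrow> y"
      unfolding closure_sequential by blast
    then have "\<forall>n. \<exists>w. (q n, w) \<in> R"
      by fastforce
    then obtain v where v: "\<And>n. (q n, v n) \<in> R"
      by (auto dest!: choice)
    have "Cauchy v"
    proof (rule metric_CauchyI)
      fix r :: real
      assume "0 < r"
      then obtain M where M: "\<And>m n. m \<ge> M \<Longrightarrow> n \<ge> M \<Longrightarrow> dist (q m) (q n) < r"
        using LIMSEQ_imp_Cauchy[OF q(2)] unfolding Cauchy_def by blast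
      have "dist (v m) (v n) \<le> dist (q m) (q n)" for m n
        using contr[of "q m - q n" "v m - v n"] subspace_diff[OF R v v, of m n]
        by (simp add: dist_norm)
      with M show "\<exists>M. \<forall>m\<ge>M. \<forall>n\<ge>M. dist (v m) (v n) < r"
        by (intro exI[of _ M]) (meson le_less_trans)
    qed
    then obtain w where "v \<longlonglongrightarrow> w"
      using Cauchy_convergent convergent_def by blast
    then have "(\<lambda>n. (q n, v n)) \<longlonglongrightarrow> (y, w)"
      by (rule tendsto_Pair[OF q(2)])
    with v have "(y, w) \<in> G"
      unfolding G_def closure_sequential by (intro exI[of _ "\<lambda>n. (q n, v n)"]) simp
    then show ?thesis ..
  qed
  define g where "g y = (THE w. (y, w) \<in> G)" for y
  have g: "(y, g y) \<in> G" for y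
  proof -
    have "\<exists>!w. (y, w) \<in> G"
      using total[of y] by (rule ex_ex1I) (rule uniq[of y])
    then show ?thesis
      unfolding g_def by (rule theI')
  qed
  have g_eq: "g y = w" if "(y, w) \<in> G" for y w
    using uniq[OF g that] .
  have "bounded_linear g"
  proof (rule bounded_linear_intro[where K = 1])
    show "g (x + y) = g x + g y" for x y
      using g_eq subspace_add[OF G g g] by simp
    show "g (r *\<^sub>R x) = r *\<^sub>R g x" for r x
      using g_eq subspace_scale[OF G g, of r x] by simp
    show "norm (g x) \<le> norm x * 1" for x
      using G_contr[OF g] by simp
  qed
  then have apply_g: "blinfun_apply (Blinfun g) = g"
    by (rule bounded_linear_Blinfun_apply)
  show thesis
  proof (rule that)
    show "norm (Blinfun g) \<le> 1"
      by (rule norm_blinfun_bound) (use G_contr[OF g] in \<open>auto simp: apply_g\<close>)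
    show "blinfun_apply (Blinfun g) y = w" if "(y, w) \<in> R" for y w
      unfolding apply_g using that closure_subset[of R] by (intro g_eq) (auto simp: G_def)
  qed
qed

section \<open>The 1-unconditional basis of \<open>A(N\<^sub>n)\<close>\<close>

text \<open>An absolute normalized norm on the plane is increasing in each coordinate on the positive
  quadrant. Iterating it keeps this monotonicity, and that is what makes the basis 1-unconditional.\<close>

locale monotone_A_space =
  fixes N :: "nat \<Rightarrow> real \<Rightarrow> real \<Rightarrow> real" and e :: "nat \<Rightarrow> 'a::banach"
  assumes N_mono: "\<lbrakk>0 \<le> s; s \<le> s'; 0 \<le> t; t \<le> t'\<rbrakk> \<Longrightarrow> N (Suc n) s t \<le> N (Suc n) s' t'"
    and N_right_zero: "0 \<le> s \<Longrightarrow> N (Suc n) s 0 = s"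
    and N_left_zero: "0 \<le> t \<Longrightarrow> N (Suc n) 0 t = t"
    and A_space: "is_A_space N e"
begin

lemma N_ge_left: "\<lbrakk>0 \<le> s; 0 \<le> t\<rbrakk> \<Longrightarrow> s \<le> N (Suc n) s t"
  using N_mono[of s s 0 t n] N_right_zero[of s n] by simp

lemma N_ge_right: "\<lbrakk>0 \<le> s; 0 \<le> t\<rbrakk> \<Longrightarrow> t \<le> N (Suc n) s t"
  using N_mono[of 0 s t t n] N_left_zero[of t n] by simp

lemma iterated_norm_nonneg: "0 \<le> iterated_norm N n x"
  by (induction n) (auto intro: order_trans[OF _ N_ge_left])

lemma iterated_norm_mono:
  "(\<And>j. \<bar>x j\<bar> \<le> \<bar>y j\<bar>) \<Longrightarrow> iterated_norm N n x \<le> iterated_norm N n y"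
  by (induction n) (auto intro: N_mono iterated_norm_nonneg)

lemma abs_coordinate_le_iterated_norm: "j \<le> n \<Longrightarrow> \<bar>x j\<bar> \<le> iterated_norm N n x"
proof (induction n)
  case (Suc n)
  then show ?case
    using N_ge_left[OF iterated_norm_nonneg[of n x] abs_ge_zero[of "x (Suc n)"], of n]
      N_ge_right[OF iterated_norm_nonneg[of n x] abs_ge_zero[of "x (Suc n)"], of n]
    by (cases "j = Suc n") auto
qed simp

lemma norm_finite_sum:
  "\<forall>j>n. x j = 0 \<Longrightarrow> norm (\<Sum>j\<le>n. x j *\<^sub>R e j) = iterated_norm N n x"
  using A_space unfolding is_A_space_def by blast

lemma norm_two_terms: "norm (a *\<^sub>R e 0 + b *\<^sub>R e (Suc n)) = N (Suc n) \<bar>a\<bar> \<bar>b\<bar>"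
proof -
  define x where "x j = (if j = 0 then a else if j = Suc n then b else 0)" for j
  have "iterated_norm N m x = \<bar>a\<bar>" if "m \<le> n" for m
    using that by (induction m) (auto simp: x_def N_right_zero)
  moreover have "(\<Sum>j\<le>n. x j *\<^sub>R e j) = (\<Sum>j\<in>{0}. x j *\<^sub>R e j)"
    by (rule sum.mono_neutral_right) (auto simp: x_def)
  ultimately show ?thesis
    using norm_finite_sum[of "Suc n" x] by (simp add: x_def)
qed

text \<open>The pairs \<open>(e\<^sub>j, u\<^sub>j)\<close> span a contractive relation; in particular every linear relation among
  the \<open>e\<^sub>j\<close> also holds among the \<open>u\<^sub>j\<close>, which makes the map well defined.\<close>

lemma basis_map_extends_to_contraction:
  fixes u :: "nat \<Rightarrow> 'b::banach"
  assumes "\<And>x n. \<forall>j>n. x j = 0 \<Longrightarrow> norm (\<Sum>j\<le>n. x j *\<^sub>R u j) \<le> norm (\<Sum>j\<le>n. x j *\<^sub>R e j)"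
  obtains T :: "'a \<Rightarrow>\<^sub>L 'b" where "norm T \<le> 1" and "\<And>j. blinfun_apply T (e j) = u j"
proof -
  define R where "R = span (range (\<lambda>j. (e j, u j)))"
  have "norm w \<le> norm y" if yw: "(y, w) \<in> R" for y w
  proof -
    obtain x n where "\<forall>j>n. x j = 0" and "(y, w) = (\<Sum>j\<le>n. x j *\<^sub>R (e j, u j))"
      by (rule span_range_eq_finite_sums[OF yw[unfolded R_def]])
    then show ?thesis
      using assms[of n x] by (simp add: sum_prod prod_eq_iff)
  qed
  moreover have "fst ` R = span (range e)"
    unfolding R_def using linear_span_image[OF linear_fst, of "range (\<lambda>j. (e j, u j))"]
    by (simp add: image_image)
  then have "closure (fst ` R) = UNIV"
    using A_space by (simp add: is_A_space_def)
  moreover have "subspace R"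
    by (simp add: R_def)
  ultimately show thesis
  proof (elim contractive_subspace_extends_to_blinfun)
    fix T :: "'a \<Rightarrow>\<^sub>L 'b"
    assume "norm T \<le> 1" and "\<And>y w. (y, w) \<in> R \<Longrightarrow> blinfun_apply T y = w"
    then show thesis
      by (intro that) (auto simp: R_def intro!: span_base)
  qed
qed

lemma diagonal_contraction:
  assumes "\<And>j. \<bar>d j\<bar> \<le> 1"
  obtains D :: "'a \<Rightarrow>\<^sub>L 'a" where "norm D \<le> 1" and "\<And>j. blinfun_apply D (e j) = d j *\<^sub>R e j"
proof (rule basis_map_extends_to_contraction[of "\<lambda>j. d j *\<^sub>R e j"])
  fix x :: "nat \<Rightarrow> real" and n
  assume "\<forall>j>n. x j = 0"
  then have "norm (\<Sum>j\<le>n. (x j * d j) *\<^sub>R e j) \<le> norm (\<Sum>j\<le>n. x j *\<^sub>R e j)"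
    using assms by (auto simp: norm_finite_sum abs_mult intro!: iterated_norm_mono mult_left_le)
  then show "norm (\<Sum>j\<le>n. x j *\<^sub>R d j *\<^sub>R e j) \<le> norm (\<Sum>j\<le>n. x j *\<^sub>R e j)"
    by simp
qed (rule that)

lemma zeroth_coordinate_functional:
  obtains f :: "'a \<Rightarrow>\<^sub>L real"
  where "blinfun_apply f (e 0) = 1" and "\<And>j. blinfun_apply f (e (Suc j)) = 0"
proof (rule basis_map_extends_to_contraction[of "\<lambda>j. of_bool (j = 0) :: real"])
  fix x :: "nat \<Rightarrow> real" and n
  assume "\<forall>j>n. x j = 0"
  moreover have "(\<Sum>j\<le>n. x j *\<^sub>R of_bool (j = 0)) = x 0"
    by (simp add: of_bool_def if_distrib[of "\<lambda>r. _ * r"] cong: if_cong)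
  ultimately show "norm (\<Sum>j\<le>n. x j *\<^sub>R (of_bool (j = 0) :: real)) \<le> norm (\<Sum>j\<le>n. x j *\<^sub>R e j)"
    using abs_coordinate_le_iterated_norm[of 0 n x] by (simp add: norm_finite_sum)
next
  fix T :: "'a \<Rightarrow>\<^sub>L real"
  assume "\<And>j. blinfun_apply T (e j) = of_bool (j = 0)"
  then show thesis
    by (intro that[of T]) simp_all
qed

lemma blinfun_eq_if_eq_on_basis:
  fixes S T :: "'a \<Rightarrow>\<^sub>L 'b::real_normed_vector"
  assumes "\<And>j. blinfun_apply S (e j) = blinfun_apply T (e j)"
  shows "S = T"
proof -
  have "subspace {x. blinfun_apply (S - T) x = 0}"
    by (simp add: subspace_def blinfun.bilinear_simps)
  then have "span (range e) \<subseteq> {x. blinfun_apply (S - T) x = 0}"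
    by (rule span_minimal[rotated]) (auto simp: assms blinfun.bilinear_simps)
  moreover have "closed {x. blinfun_apply (S - T) x = 0}"
    by (intro closed_Collect_eq continuous_intros)
  ultimately have "closure (span (range e)) \<subseteq> {x. blinfun_apply (S - T) x = 0}"
    by (rule closure_minimal)
  then have "blinfun_apply (S - T) x = 0" for x
    using A_space by (auto simp: is_A_space_def)
  then show ?thesis
    by (intro blinfun_eqI) (simp add: blinfun.bilinear_simps)
qed

section \<open>A diagonal operator that does not attain its norm\<close>

text \<open>If all entries of the diagonal were at most some \<open>b < 1\<close>, the strict inequality would be
  immediate. In general such a bound holds for the first entries only, up to any chosen index.
  Cutting all entries off at \<open>b\<close> leaves \<open>b\<close> times a diagonal contraction. The rest is \<open>1 - b\<close>
  times a diagonal contraction that kills the first basis vectors, so it lowers the norm of \<open>x\<close>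
  once \<open>x\<close> is closer to their span than to 0.\<close>

lemma increasing_diagonal_strictly_decreases_norm:
  fixes T :: "'a \<Rightarrow>\<^sub>L 'a"
  assumes T: "\<And>j. blinfun_apply T (e j) = \<beta> j *\<^sub>R e j"
    and \<beta>: "mono \<beta>" "\<And>j. 0 < \<beta> j" "\<And>j. \<beta> j < 1" and "x \<noteq> 0"
  shows "norm (blinfun_apply T x) < norm x"
proof -
  have "x \<in> closure (span (range e))"
    using A_space by (simp add: is_A_space_def)
  then obtain y where y: "y \<in> span (range e)" "norm (x - y) < norm x"
    using \<open>x \<noteq> 0\<close> unfolding closure_approachable
    by (metis dist_norm norm_minus_commute zero_less_norm_iff)
  obtain a n where y_eq: "y = (\<Sum>j\<le>n. a j *\<^sub>R e j)"
    by (rule span_range_eq_finite_sums[OF y(1)])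
  define b where "b = \<beta> n"
  have b: "0 < b" "b < 1"
    by (simp_all add: b_def \<beta>)
  \<comment> \<open>The part of \<open>\<beta>\<close> in excess of \<open>b\<close>, scaled to have entries in \<open>[0, 1]\<close>, so that
    \<open>\<beta>\<^sub>j = b (min \<beta>\<^sub>j b / b) + (1 - b) \<eta>\<^sub>j\<close>.\<close>
  define \<eta> where "\<eta> j = (\<beta> j - min (\<beta> j) b) / (1 - b)" for j
  have \<eta>: "\<bar>\<eta> j\<bar> \<le> 1" "j \<le> n \<Longrightarrow> \<eta> j = 0" for j
    using b \<beta>(3)[of j] monoD[OF \<beta>(1), of j n] by (auto simp: \<eta>_def b_def min_def)
  obtain A :: "'a \<Rightarrow>\<^sub>L 'a"
    where A: "norm A \<le> 1" "\<And>j. blinfun_apply A (e j) = (min (\<beta> j) b / b) *\<^sub>R e j"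
    using diagonal_contraction[of "\<lambda>j. min (\<beta> j) b / b"] b \<beta>(2)
    by (metis abs_of_pos divide_le_eq_1_pos divide_pos_pos min.cobounded2 min_less_iff_conj)
  obtain D :: "'a \<Rightarrow>\<^sub>L 'a"
    where D: "norm D \<le> 1" "\<And>j. blinfun_apply D (e j) = \<eta> j *\<^sub>R e j"
    using diagonal_contraction[of \<eta>] \<eta>(1) by blast
  have "T = b *\<^sub>R A + (1 - b) *\<^sub>R D"
  proof (rule blinfun_eq_if_eq_on_basis)
    fix j
    have "b * (min (\<beta> j) b / b) + (1 - b) * \<eta> j = \<beta> j"
      using b by (simp add: \<eta>_def)
    then show "blinfun_apply T (e j) = blinfun_apply (b *\<^sub>R A + (1 - b) *\<^sub>R D) (e j)"
      by (simp add: T A D blinfun.bilinear_simps flip: scaleR_add_left)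
  qed
  then have Tx: "blinfun_apply T x = b *\<^sub>R blinfun_apply A x + (1 - b) *\<^sub>R blinfun_apply D x"
    by (simp add: blinfun.bilinear_simps)
  have contraction: "norm (blinfun_apply S z) \<le> norm z" if "norm S \<le> 1" for S :: "'a \<Rightarrow>\<^sub>L 'a" and z
    using norm_blinfun[of S z] mult_right_mono[OF that norm_ge_zero[of z]] by simp
  have "blinfun_apply D y = 0"
    by (simp add: y_eq blinfun.bilinear_simps D \<eta>(2))
  then have "norm (blinfun_apply D x) \<le> norm (x - y)"
    using contraction[OF D(1), of "x - y"] by (simp add: blinfun.bilinear_simps)
  then have "norm (blinfun_apply D x) < norm x"
    using y(2) by simp
  have "norm (blinfun_apply T x) \<le> b * norm (blinfun_apply A x) + (1 - b) * norm (blinfun_apply D x)"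
    unfolding Tx using b norm_triangle_ineq[of "b *\<^sub>R blinfun_apply A x" "(1 - b) *\<^sub>R blinfun_apply D x"]
    by simp
  also have "\<dots> < b * norm x + (1 - b) * norm x"
    using b contraction[OF A(1)] \<open>norm (blinfun_apply D x) < norm x\<close>
    by (intro add_le_less_mono mult_left_mono mult_strict_left_mono) auto
  finally show ?thesis
    by (simp add: algebra_simps)
qed

text \<open>A maximizing sequence for a diagonal operator with entries increasing to 1 can run along the
  basis. If adding \<open>s e\<^sub>0\<close> to \<open>e\<^sub>n\<close> does not change the norm in the limit, the sequence stays
  maximizing when it carries this fixed component, and then it is not weakly null.\<close>

lemma not_weak_maximizing_property:
  assumes "0 < s" and flat: "(\<lambda>n. N (Suc n) s 1) \<longlonglongrightarrow> 1"
  shows "\<not> weak_maximizing_property TYPE('a) TYPE('a)"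
proof
  assume WMP: "weak_maximizing_property TYPE('a) TYPE('a)"
  define \<beta> :: "nat \<Rightarrow> real" where "\<beta> j = 1 - inverse (real (Suc (Suc j)))" for j
  have \<beta>: "mono \<beta>" "\<And>j. 0 < \<beta> j" "\<And>j. \<beta> j < 1"
    by (auto simp: \<beta>_def mono_def field_simps)
  have \<beta>_lim: "(\<lambda>n. \<beta> (Suc n)) \<longlonglongrightarrow> 1"
    unfolding \<beta>_def
    using tendsto_diff[OF tendsto_const LIMSEQ_Suc[OF LIMSEQ_Suc[OF LIMSEQ_inverse_real_of_nat]], of 1]
    by simp
  obtain T :: "'a \<Rightarrow>\<^sub>L 'a"
    where T: "norm T \<le> 1" "\<And>j. blinfun_apply T (e j) = \<beta> j *\<^sub>R e j"
    using diagonal_contraction[of \<beta>] \<beta> by (metis abs_of_pos less_imp_le)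
  define z where "z n = (1 / N (Suc n) s 1) *\<^sub>R (s *\<^sub>R e 0 + 1 *\<^sub>R e (Suc n))" for n
  have N_ge_1: "1 \<le> N (Suc n) s 1" for n
    using N_ge_right[of s 1 n] \<open>0 < s\<close> by simp
  then have N_pos: "0 < N (Suc n) s 1" for n
    by (meson less_le_trans zero_less_one)
  have norm_z: "norm (z n) = 1" for n
    using norm_two_terms[of s 1 n] N_pos[of n] \<open>0 < s\<close> by (simp add: z_def)
  have "norm (blinfun_apply T (z n)) = N (Suc n) (\<beta> 0 * s) (\<beta> (Suc n)) / N (Suc n) s 1" for n
    using norm_two_terms[of "\<beta> 0 * s" "\<beta> (Suc n)" n] N_pos[of n] \<open>0 < s\<close> \<beta>(2)[of 0] \<beta>(2)[of "Suc n"]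
    by (simp add: z_def blinfun.bilinear_simps T mult.commute abs_mult)
  then have lower: "\<beta> (Suc n) / N (Suc n) s 1 \<le> norm (blinfun_apply T (z n))" for n
    using N_ge_right[of "\<beta> 0 * s" "\<beta> (Suc n)" n] N_pos[of n] \<open>0 < s\<close> \<beta>(2)[of 0] \<beta>(2)[of "Suc n"]
    by (simp add: divide_right_mono)
  have upper: "norm (blinfun_apply T (z n)) \<le> norm T" for n
    using norm_blinfun[of T "z n"] by (simp add: norm_z)
  have lower_lim: "(\<lambda>n. \<beta> (Suc n) / N (Suc n) s 1) \<longlonglongrightarrow> 1"
    using tendsto_divide[OF \<beta>_lim flat] by simp
  have "1 \<le> norm T"
    by (rule LIMSEQ_le_const2[OF lower_lim]) (use lower upper order_trans in blast)
  then have norm_T: "norm T = 1"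
    using T(1) by simp
  have "(\<lambda>n. norm (blinfun_apply T (z n))) \<longlonglongrightarrow> 1"
    by (rule tendsto_sandwich[OF _ _ lower_lim tendsto_const]) (use lower upper norm_T in auto)
  then have "maximizing_sequence T z"
    by (simp add: maximizing_sequence_def norm_z norm_T)
  moreover have "\<not> weakly_null z"
  proof
    assume "weakly_null z"
    obtain f :: "'a \<Rightarrow>\<^sub>L real"
      where f: "blinfun_apply f (e 0) = 1" "\<And>j. blinfun_apply f (e (Suc j)) = 0"
      using zeroth_coordinate_functional by blast
    have "(\<lambda>n. blinfun_apply f (z n)) \<longlonglongrightarrow> 0"
      using \<open>weakly_null z\<close> unfolding weakly_null_def by blast
    moreover have "blinfun_apply f (z n) = s / N (Suc n) s 1" for n
      by (simp add: z_def blinfun.bilinear_simps f)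
    moreover have "(\<lambda>n. s / N (Suc n) s 1) \<longlonglongrightarrow> s"
      using tendsto_divide[OF tendsto_const flat, of s] by simp
    ultimately show False
      using LIMSEQ_unique \<open>0 < s\<close> by fastforce
  qed
  ultimately have "attains_norm T"
    using WMP unfolding weak_maximizing_property_def by blast
  then obtain x where "norm x = 1" "norm (blinfun_apply T x) = 1"
    unfolding attains_norm_def norm_T by blast
  then show False
    using increasing_diagonal_strictly_decreases_norm[OF T(2) \<beta>, of x] by force
qed

end

section \<open>The spaces \<open>X\<^sub>c\<close>\<close>

lemma N_c_mono:
  assumes "0 < c" "c < 1" "0 \<le> s" "s \<le> s'" "0 \<le> t" "t \<le> t'"
  shows "N_c c (Suc n) s t \<le> N_c c (Suc n) s' t'"
proof -
  have "c ^ (2 * Suc n) \<le> 1"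
    using assms by (intro power_le_one) auto
  then show ?thesis
    unfolding N_c_def using assms
    by (intro real_root_le_mono add_mono mult_left_mono power_mono) auto
qed

lemma N_c_right_zero: "0 \<le> s \<Longrightarrow> N_c c (Suc n) s 0 = s"
  using real_root_power_cancel[of "2 * Suc n" s]
  by (simp add: N_c_def zero_power flip: power_mult del: power_Suc mult_Suc_right)

lemma N_c_left_zero: "0 \<le> t \<Longrightarrow> N_c c (Suc n) 0 t = t"
  using real_root_power_cancel[of "2 * Suc n" t]
  by (simp add: N_c_def algebra_simps
      flip: power_mult del: power_Suc mult_Suc_right)

text \<open>At \<open>s\<^sup>2 = 1 - c\<^sup>2\<close> the power \<open>(s\<^sup>2 + c\<^sup>2)\<^sup>n\<close> equals 1, so the expression under the root lies
  between 1 and 2.\<close>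

lemma N_c_flat:
  assumes "0 < c" "c < 1"
  shows "(\<lambda>n. N_c c (Suc n) (sqrt (1 - c\<^sup>2)) 1) \<longlonglongrightarrow> 1"
proof (rule tendsto_sandwich)
  have c2: "0 \<le> 1 - c\<^sup>2"
    using assms by (simp add: power_le_one)
  have pow: "0 \<le> c ^ (2 * Suc n)" "c ^ (2 * Suc n) \<le> 1" for n
    using assms by (auto intro: power_le_one zero_le_power simp del: power_Suc mult_Suc_right)
  have eq: "N_c c (Suc n) (sqrt (1 - c\<^sup>2)) 1 = root (2 * Suc n) (2 - c ^ (2 * Suc n))" for n
    using c2 by (simp add: N_c_def del: power_Suc mult_Suc_right)
  show "\<forall>\<^sub>F n in sequentially. 1 \<le> N_c c (Suc n) (sqrt (1 - c\<^sup>2)) 1"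
    unfolding eq using pow by (intro always_eventually allI) (subst real_root_ge_1_iff; simp del: power_Suc mult_Suc_right)
  show "\<forall>\<^sub>F n in sequentially. N_c c (Suc n) (sqrt (1 - c\<^sup>2)) 1 \<le> root (2 * Suc n) 2"
    unfolding eq using pow by (intro always_eventually allI real_root_le_mono) (simp_all del: power_Suc mult_Suc_right)
  have "filterlim (\<lambda>n::nat. 2 * Suc n) sequentially sequentially"
    by (rule filterlim_subseq) (auto simp: strict_mono_def)
  then show "(\<lambda>n. root (2 * Suc n) 2) \<longlonglongrightarrow> 1"
    by (rule filterlim_compose[OF LIMSEQ_root_const[of 2], rotated]) simp
qed simp

theorem theorem4p2:
  fixes c :: real and e :: "nat \<Rightarrow> 'a::banach"
  assumes "0 < c" and "c < 1"
    and "is_X_c c e"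
  shows "\<not> weak_maximizing_property TYPE('a) TYPE('a)"
proof -
  interpret monotone_A_space "N_c c" e
    using assms by unfold_locales (auto simp: N_c_mono N_c_right_zero N_c_left_zero is_X_c_def)
  have "0 < sqrt (1 - c\<^sup>2)"
    using assms(1,2) by (simp add: power_less_one_iff abs_square_less_1)
  then show ?thesis
    using N_c_flat[OF assms(1,2)] by (rule not_weak_maximizing_property)
qed

end
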